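(* Let $P$ be a poset, $\rho$ a height-difference function on $P$, and $\mathcal C$ a complete and cocomplete category. If $(P,\rho)$ has the connected intersection property (CIP), then $d_\rho$ satisfies an additively $c(\rho)$-relaxed triangle inequality on $\mathrm{Fun}(P,\mathcal C)$, i.e. $$d_\rho(M,N)\le d_\rho(M,X)+d_\rho(X,N)+c(\rho)\quad\text{for all }M,X,N\in\mathrm{Fun}(P,\mathcal C).$$ In particular, if $c(\rho)=0$, then $d_\rho$ is an extended pseudo-distance on $\mathrm{Fun}(P,\mathcal C)$.
   Context: A poset $P$ is regarded as a category (a unique morphism $a\to b$ iff $a\le b$), and $\mathrm{Fun}(P,\mathcal C)$ is the category of functors $P\to\mathcal C$ and natural transformations. All infima of empty sets are $\infty$. A height-difference function on $P$ is a function $\rho:\{(a,b)\in P\times P: a\le b\}\to[0,\infty]$ with $\rho(a,a)=0$ for all $a$ and $\rho(a,c)\ge\rho(a,b)+\rho(b,c)$ whenever $a\le b\le c$. For $a\in P$ and real $r\ge 0$ put $a^{\downarrow_r}=\{x\in P: x\le a,\ \rho(x,a)\ge r\}$ and $a^{\uparrow_r}=\{x\in P: x\ge a,\ \rho(a,x)\ge r\}$ (full subposets). Endofunctors $\mathsf L_r=\mathsf L_r^\rho$ and $\mathsf R_r=\mathsf R_r^\rho$ of $\mathrm{Fun}(P,\mathcal C)$: $(\mathsf L_rM)(a)=\operatorname{colim} M|_{a^{\downarrow_r}}$ and $(\mathsf R_rM)(a)=\lim M|_{a^{\uparrow_r}}$, with structure morphisms for $a\le b$ (using $a^{\downarrow_r}\subseteq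 b^{\downarrow_r}$, $b^{\uparrow_r}\subseteq a^{\uparrow_r}$) and the action on morphisms induced by the universal properties. Write $\alpha_{a,M}(x):M(x)\to(\mathsf L_rM)(a)$ ($x\in a^{\downarrow_r}$) and $\beta_{a,M}(y):(\mathsf R_rM)(a)\to M(y)$ ($y\in a^{\uparrow_r}$) for the canonical maps. The functor $\mathsf L_r$ is left adjoint to $\mathsf R_r$; for $p:M\to\mathsf R_rN$, its adjoint $p^\sharp:\mathsf L_rM\to N$ is the unique morphism with $p^\sharp(a)\circ\alpha_{a,M}(x)=\beta_{x,N}(a)\circ p(x)$ for all $a\in P$, $x\in a^{\downarrow_r}$. Let $\eta^{\mathsf L}_{r,M}:\mathsf L_rM\to M$ and $\eta^{\mathsf R}_{r,M}:M\to\mathsf R_rM$ be induced by the structure maps $M(x\le a)$, $x\in a^{\downarrow_r}$, respectively $M(a\le y)$, $y\in a^{\uparrow_r}$, and set $e_{r,M}=\eta^{\mathsf R}_{r,M}\circ\eta^{\mathsf L}_{r,M}:\mathsf L_rM\to\mathsf R_rM$. $M,N\in\mathrm{Fun}(P,\mathcal C)$ are $r$-height-interleaved with respect to $\rho$ if there are $p:M\to\mathsf R_rN$ and $q:N\to\mathsf R_rM$ with $e_{r,M}=q\circ p^\sharp$ and $e_{r,N}=p\circ q^\sharp$. The height-interleaving distance is $d_\rho(M,N)=\inf\{r\ge0: M,N \text{ are } r\text{-height-interleaved w.r.t. }\rho\}\in[0,\infty]$. CIP: $(P,\rho)$ has the connected intersection property if for all $a,q\in P$ and $s,r\ge0$ the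 full subposet $I_{s,r}(a,q)=a^{\downarrow_s}\cap q^{\uparrow_r}$ is empty or connected (any two elements are joined by a finite zigzag of comparabilities inside it). For $u,v\in[0,\infty]$ set $|u-v|_\infty=|u-v|$ if $u,v<\infty$, $0$ if $u=v=\infty$, and $\infty$ otherwise. For $c\ge0$, condition (IV$_c$): for any $a\le b$ in $P$ and any $t\in[0,\infty)$ with $t\le\rho(a,b)$ there exists $z\in P$ with $a\le z\le b$, $|\rho(a,z)-t|_\infty\le c/2$ and $|\rho(z,b)-(\rho(a,b)-t)|_\infty\le c/2$. Then $c(\rho)=\inf\{c\ge0:(P,\rho)\text{ satisfies (IV}_c)\}\in[0,\infty]$. An extended pseudo-distance is a $[0,\infty]$-valued function that is symmetric, vanishes on the diagonal and satisfies the triangle inequality. *)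

theory Defs
  imports "HOL-Library.Extended_Nonnegative_Real"
begin

section \<open>Categories, functors, limits and colimits\<close>

record ('o, 'm) cat =
  Ob :: "'o set"
  Ar :: "'m set"
  Dom :: "'m \<Rightarrow> 'o"
  Cod :: "'m \<Rightarrow> 'o"
  Idn :: "'o \<Rightarrow> 'm"
  Comp :: "'m \<Rightarrow> 'm \<Rightarrow> 'm"  \<comment> \<open>\<open>Comp C g f\<close> is \<open>g\<close> after \<open>f\<close>\<close>

definition Hom :: "('o, 'm) cat \<Rightarrow> 'o \<Rightarrow> 'o \<Rightarrow> 'm set" where
  "Hom C a b = {f \<in> Ar C. Dom C f = a \<and> Cod C f = b}"

locale category =
  fixes C :: "('o, 'm) cat"
  assumes dom_in: "f \<in> Ar C \<Longrightarrow> Dom C f \<in> Ob C"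
    and cod_in: "f \<in> Ar C \<Longrightarrow> Cod C f \<in> Ob C"
    and idn_in: "a \<in> Ob C \<Longrightarrow> Idn C a \<in> Hom C a a"
    and comp_in: "f \<in> Hom C a b \<Longrightarrow> g \<in> Hom C b c \<Longrightarrow> Comp C g f \<in> Hom C a c"
    and comp_idn: "f \<in> Hom C a b \<Longrightarrow> Comp C f (Idn C a) = f"
    and idn_comp: "f \<in> Hom C a b \<Longrightarrow> Comp C (Idn C b) f = f"
    and comp_assoc: "f \<in> Hom C a b \<Longrightarrow> g \<in> Hom C b c \<Longrightarrow> h \<in> Hom C c d \<Longrightarrow>
      Comp C h (Comp C g f) = Comp C (Comp C h g) f"

record ('i, 'j, 'o, 'm) func =
  fob :: "'i \<Rightarrow> 'o"
  far :: "'j \<Rightarrow> 'm"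

definition is_functor :: "('i, 'j) cat \<Rightarrow> ('o, 'm) cat \<Rightarrow> ('i, 'j, 'o, 'm) func \<Rightarrow> bool" where
  "is_functor J C F \<longleftrightarrow>
     (\<forall>i \<in> Ob J. fob F i \<in> Ob C) \<and>
     (\<forall>i \<in> Ob J. \<forall>j \<in> Ob J. \<forall>f \<in> Hom J i j. far F f \<in> Hom C (fob F i) (fob F j)) \<and>
     (\<forall>i \<in> Ob J. far F (Idn J i) = Idn C (fob F i)) \<and>
     (\<forall>i \<in> Ob J. \<forall>j \<in> Ob J. \<forall>k \<in> Ob J. \<forall>f \<in> Hom J i j. \<forall>g \<in> Hom J j k.
        far F (Comp J g f) = Comp C (far F g) (far F f))"

definition is_nat_trans ::
  "('i, 'j) cat \<Rightarrow> ('o, 'm) cat \<Rightarrow> ('i, 'j, 'o, 'm) func \<Rightarrow> ('i, 'j, 'o, 'm) func \<Rightarrow>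
    ('i \<Rightarrow> 'm) \<Rightarrow> bool" where
  "is_nat_trans J C F G t \<longleftrightarrow>
     (\<forall>i \<in> Ob J. t i \<in> Hom C (fob F i) (fob G i)) \<and>
     (\<forall>i \<in> Ob J. \<forall>j \<in> Ob J. \<forall>f \<in> Hom J i j.
        Comp C (t j) (far F f) = Comp C (far G f) (t i))"

definition is_cocone ::
  "('i, 'j) cat \<Rightarrow> ('o, 'm) cat \<Rightarrow> ('i, 'j, 'o, 'm) func \<Rightarrow> 'o \<Rightarrow> ('i \<Rightarrow> 'm) \<Rightarrow> bool" where
  "is_cocone J C D X k \<longleftrightarrow>
     X \<in> Ob C \<and> (\<forall>i \<in> Ob J. k i \<in> Hom C (fob D i) X) \<and>
     (\<forall>i \<in> Ob J. \<forall>j \<in> Ob J. \<forall>f \<in> Hom J i j. Comp C (k j) (far D f) = k i)"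

definition is_cone ::
  "('i, 'j) cat \<Rightarrow> ('o, 'm) cat \<Rightarrow> ('i, 'j, 'o, 'm) func \<Rightarrow> 'o \<Rightarrow> ('i \<Rightarrow> 'm) \<Rightarrow> bool" where
  "is_cone J C D X k \<longleftrightarrow>
     X \<in> Ob C \<and> (\<forall>i \<in> Ob J. k i \<in> Hom C X (fob D i)) \<and>
     (\<forall>i \<in> Ob J. \<forall>j \<in> Ob J. \<forall>f \<in> Hom J i j. Comp C (far D f) (k i) = k j)"

definition is_colimit ::
  "('i, 'j) cat \<Rightarrow> ('o, 'm) cat \<Rightarrow> ('i, 'j, 'o, 'm) func \<Rightarrow> 'o \<Rightarrow> ('i \<Rightarrow> 'm) \<Rightarrow> bool" where
  "is_colimit J C D X k \<longleftrightarrow>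
     is_cocone J C D X k \<and>
     (\<forall>Y h. is_cocone J C D Y h \<longrightarrow>
        (\<exists>!u. u \<in> Hom C X Y \<and> (\<forall>i \<in> Ob J. Comp C u (k i) = h i)))"

definition is_limit ::
  "('i, 'j) cat \<Rightarrow> ('o, 'm) cat \<Rightarrow> ('i, 'j, 'o, 'm) func \<Rightarrow> 'o \<Rightarrow> ('i \<Rightarrow> 'm) \<Rightarrow> bool" where
  "is_limit J C D X k \<longleftrightarrow>
     is_cone J C D X k \<and>
     (\<forall>Y h. is_cone J C D Y h \<longrightarrow>
        (\<exists>!u. u \<in> Hom C Y X \<and> (\<forall>i \<in> Ob J. Comp C (k i) u = h i)))"

text \<open>
  Smallness is relative to a type \<open>'u\<close> that plays the role of the universe: a category is small
  if its objects are drawn from \<open>'u\<close> and its arrows from \<open>'u \<times> 'u\<close>, the type in which the arrows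
  of a poset on (a subset of) \<open>'u\<close> live. For infinite \<open>'u\<close> these are, up to isomorphism, exactly
  the categories with at most \<open>|'u|\<close> objects and arrows. A complete category in the usual sense
  is complete in this sense for every \<open>'u\<close>, so nothing is lost in a hypothesis.
\<close>

definition complete_category :: "'u itself \<Rightarrow> ('o, 'm) cat \<Rightarrow> bool" where
  "complete_category _ C \<longleftrightarrow>
     category C \<and>
     (\<forall>(J :: ('u, 'u \<times> 'u) cat) D. category J \<longrightarrow> is_functor J C D \<longrightarrow>
        (\<exists>X k. is_limit J C D X k))"

definition cocomplete_category :: "'u itself \<Rightarrow> ('o, 'm) cat \<Rightarrow> bool" where
  "cocomplete_category _ C \<longleftrightarrow>
     category C \<and>
     (\<forall>(J :: ('u, 'u \<times> 'u) cat) D. category J \<longrightarrow> is_functor J C D \<longrightarrow>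
        (\<exists>X k. is_colimit J C D X k))"

text \<open>A fixed choice of colimits and limits, and the morphisms induced by their universal
  properties.\<close>

definition chosen_colimit :: "('i, 'j) cat \<Rightarrow> ('o, 'm) cat \<Rightarrow> ('i, 'j, 'o, 'm) func \<Rightarrow> 'o \<times> ('i \<Rightarrow> 'm)"
  where "chosen_colimit J C D = (SOME c. is_colimit J C D (fst c) (snd c))"

definition colim_desc ::
  "('i, 'j) cat \<Rightarrow> ('o, 'm) cat \<Rightarrow> ('i, 'j, 'o, 'm) func \<Rightarrow> 'o \<Rightarrow> ('i \<Rightarrow> 'm) \<Rightarrow> 'm" where
  "colim_desc J C D Y h =
     (THE u. u \<in> Hom C (fst (chosen_colimit J C D)) Y \<and>
        (\<forall>i \<in> Ob J. Comp C u (snd (chosen_colimit J C D) i) = h i))"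

definition chosen_limit :: "('i, 'j) cat \<Rightarrow> ('o, 'm) cat \<Rightarrow> ('i, 'j, 'o, 'm) func \<Rightarrow> 'o \<times> ('i \<Rightarrow> 'm)"
  where "chosen_limit J C D = (SOME c. is_limit J C D (fst c) (snd c))"

definition lim_lift ::
  "('i, 'j) cat \<Rightarrow> ('o, 'm) cat \<Rightarrow> ('i, 'j, 'o, 'm) func \<Rightarrow> 'o \<Rightarrow> ('i \<Rightarrow> 'm) \<Rightarrow> 'm" where
  "lim_lift J C D Y h =
     (THE u. u \<in> Hom C Y (fst (chosen_limit J C D)) \<and>
        (\<forall>i \<in> Ob J. Comp C (snd (chosen_limit J C D) i) u = h i))"


section \<open>Posets and height-difference functions\<close>

text \<open>
  A poset is a relation \<open>P\<close> with \<open>Partial_order P\<close>; its set of elements is \<open>Field P\<close>, and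
  \<open>a \<le> b\<close> is \<open>(a, b) \<in> P\<close>. The full subposet on \<open>S \<subseteq> Field P\<close> is \<open>Restr P S\<close>.
\<close>

definition poset_cat :: "'u rel \<Rightarrow> ('u, 'u \<times> 'u) cat" where
  "poset_cat P = \<lparr>Ob = Field P, Ar = P, Dom = fst, Cod = snd,
     Idn = (\<lambda>a. (a, a)), Comp = (\<lambda>g f. (fst f, snd g))\<rparr>"

definition Fun :: "'u rel \<Rightarrow> ('o, 'm) cat \<Rightarrow> ('u, 'u \<times> 'u, 'o, 'm) func set" where
  "Fun P C = {M. is_functor (poset_cat P) C M}"

definition height_difference :: "'u rel \<Rightarrow> ('u \<Rightarrow> 'u \<Rightarrow> ennreal) \<Rightarrow> bool" where
  "height_difference P \<rho> \<longleftrightarrow>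
     (\<forall>a \<in> Field P. \<rho> a a = 0) \<and>
     (\<forall>a b c. (a, b) \<in> P \<longrightarrow> (b, c) \<in> P \<longrightarrow> \<rho> a b + \<rho> b c \<le> \<rho> a c)"

definition down :: "'u rel \<Rightarrow> ('u \<Rightarrow> 'u \<Rightarrow> ennreal) \<Rightarrow> real \<Rightarrow> 'u \<Rightarrow> 'u set" where
  "down P \<rho> r a = {x. (x, a) \<in> P \<and> ennreal r \<le> \<rho> x a}"

definition up :: "'u rel \<Rightarrow> ('u \<Rightarrow> 'u \<Rightarrow> ennreal) \<Rightarrow> real \<Rightarrow> 'u \<Rightarrow> 'u set" where
  "up P \<rho> r a = {x. (a, x) \<in> P \<and> ennreal r \<le> \<rho> a x}"

abbreviation down_cat ::
  "'u rel \<Rightarrow> ('u \<Rightarrow> 'u \<Rightarrow> ennreal) \<Rightarrow> real \<Rightarrow> 'u \<Rightarrow> ('u, 'u \<times> 'u) cat" where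
  "down_cat P \<rho> r a \<equiv> poset_cat (Restr P (down P \<rho> r a))"

abbreviation up_cat ::
  "'u rel \<Rightarrow> ('u \<Rightarrow> 'u \<Rightarrow> ennreal) \<Rightarrow> real \<Rightarrow> 'u \<Rightarrow> ('u, 'u \<times> 'u) cat" where
  "up_cat P \<rho> r a \<equiv> poset_cat (Restr P (up P \<rho> r a))"


section \<open>The endofunctors and the interleaving distance\<close>

text \<open>
  The restriction of \<open>M\<close> to a full subposet is \<open>M\<close> itself, regarded as a functor on the smaller
  category: the notions above only evaluate a functor on objects and arrows of its domain.
\<close>

definition colim_inj ::
  "'u rel \<Rightarrow> ('u \<Rightarrow> 'u \<Rightarrow> ennreal) \<Rightarrow> ('o, 'm) cat \<Rightarrow> real \<Rightarrow> ('u, 'u \<times> 'u, 'o, 'm) func \<Rightarrow>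
    'u \<Rightarrow> 'u \<Rightarrow> 'm" where
  "colim_inj P \<rho> C r M a = snd (chosen_colimit (down_cat P \<rho> r a) C M)"

definition lim_proj ::
  "'u rel \<Rightarrow> ('u \<Rightarrow> 'u \<Rightarrow> ennreal) \<Rightarrow> ('o, 'm) cat \<Rightarrow> real \<Rightarrow> ('u, 'u \<times> 'u, 'o, 'm) func \<Rightarrow>
    'u \<Rightarrow> 'u \<Rightarrow> 'm" where
  "lim_proj P \<rho> C r M a = snd (chosen_limit (up_cat P \<rho> r a) C M)"

definition L_fun ::
  "'u rel \<Rightarrow> ('u \<Rightarrow> 'u \<Rightarrow> ennreal) \<Rightarrow> ('o, 'm) cat \<Rightarrow> real \<Rightarrow> ('u, 'u \<times> 'u, 'o, 'm) func \<Rightarrow>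
    ('u, 'u \<times> 'u, 'o, 'm) func" where
  "L_fun P \<rho> C r M = \<lparr>
     fob = (\<lambda>a. fst (chosen_colimit (down_cat P \<rho> r a) C M)),
     far = (\<lambda>(a, b). colim_desc (down_cat P \<rho> r a) C M
       (fst (chosen_colimit (down_cat P \<rho> r b) C M)) (colim_inj P \<rho> C r M b))\<rparr>"

definition R_fun ::
  "'u rel \<Rightarrow> ('u \<Rightarrow> 'u \<Rightarrow> ennreal) \<Rightarrow> ('o, 'm) cat \<Rightarrow> real \<Rightarrow> ('u, 'u \<times> 'u, 'o, 'm) func \<Rightarrow>
    ('u, 'u \<times> 'u, 'o, 'm) func" where
  "R_fun P \<rho> C r M = \<lparr>
     fob = (\<lambda>a. fst (chosen_limit (up_cat P \<rho> r a) C M)),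
     far = (\<lambda>(a, b). lim_lift (up_cat P \<rho> r b) C M
       (fst (chosen_limit (up_cat P \<rho> r a) C M)) (lim_proj P \<rho> C r M a))\<rparr>"

definition eta_L ::
  "'u rel \<Rightarrow> ('u \<Rightarrow> 'u \<Rightarrow> ennreal) \<Rightarrow> ('o, 'm) cat \<Rightarrow> real \<Rightarrow> ('u, 'u \<times> 'u, 'o, 'm) func \<Rightarrow>
    'u \<Rightarrow> 'm" where
  "eta_L P \<rho> C r M a = colim_desc (down_cat P \<rho> r a) C M (fob M a) (\<lambda>x. far M (x, a))"

definition eta_R ::
  "'u rel \<Rightarrow> ('u \<Rightarrow> 'u \<Rightarrow> ennreal) \<Rightarrow> ('o, 'm) cat \<Rightarrow> real \<Rightarrow> ('u, 'u \<times> 'u, 'o, 'm) func \<Rightarrow>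
    'u \<Rightarrow> 'm" where
  "eta_R P \<rho> C r M a = lim_lift (up_cat P \<rho> r a) C M (fob M a) (\<lambda>y. far M (a, y))"

definition e_mor ::
  "'u rel \<Rightarrow> ('u \<Rightarrow> 'u \<Rightarrow> ennreal) \<Rightarrow> ('o, 'm) cat \<Rightarrow> real \<Rightarrow> ('u, 'u \<times> 'u, 'o, 'm) func \<Rightarrow>
    'u \<Rightarrow> 'm" where
  "e_mor P \<rho> C r M a = Comp C (eta_R P \<rho> C r M a) (eta_L P \<rho> C r M a)"

text \<open>The adjoint \<open>L\<^sub>r M \<rightarrow> N\<close> of \<open>p : M \<rightarrow> R\<^sub>r N\<close>; the cocone below makes sense because
  \<open>x \<in> down P \<rho> r a\<close> iff \<open>a \<in> up P \<rho> r x\<close>.\<close>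

definition sharp ::
  "'u rel \<Rightarrow> ('u \<Rightarrow> 'u \<Rightarrow> ennreal) \<Rightarrow> ('o, 'm) cat \<Rightarrow> real \<Rightarrow> ('u, 'u \<times> 'u, 'o, 'm) func \<Rightarrow>
    ('u, 'u \<times> 'u, 'o, 'm) func \<Rightarrow> ('u \<Rightarrow> 'm) \<Rightarrow> 'u \<Rightarrow> 'm" where
  "sharp P \<rho> C r M N p a =
     colim_desc (down_cat P \<rho> r a) C M (fob N a) (\<lambda>x. Comp C (lim_proj P \<rho> C r N x a) (p x))"

definition height_interleaved ::
  "'u rel \<Rightarrow> ('u \<Rightarrow> 'u \<Rightarrow> ennreal) \<Rightarrow> ('o, 'm) cat \<Rightarrow> real \<Rightarrow> ('u, 'u \<times> 'u, 'o, 'm) func \<Rightarrow>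
    ('u, 'u \<times> 'u, 'o, 'm) func \<Rightarrow> bool" where
  "height_interleaved P \<rho> C r M N \<longleftrightarrow>
     (\<exists>p q. is_nat_trans (poset_cat P) C M (R_fun P \<rho> C r N) p \<and>
            is_nat_trans (poset_cat P) C N (R_fun P \<rho> C r M) q \<and>
            (\<forall>a \<in> Field P. e_mor P \<rho> C r M a = Comp C (q a) (sharp P \<rho> C r M N p a)) \<and>
            (\<forall>a \<in> Field P. e_mor P \<rho> C r N a = Comp C (p a) (sharp P \<rho> C r N M q a)))"

definition height_dist ::
  "'u rel \<Rightarrow> ('u \<Rightarrow> 'u \<Rightarrow> ennreal) \<Rightarrow> ('o, 'm) cat \<Rightarrow> ('u, 'u \<times> 'u, 'o, 'm) func \<Rightarrow>
    ('u, 'u \<times> 'u, 'o, 'm) func \<Rightarrow> ennreal" where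
  "height_dist P \<rho> C M N = Inf {ennreal r |r. r \<ge> 0 \<and> height_interleaved P \<rho> C r M N}"

definition extended_pseudo_distance :: "'a set \<Rightarrow> ('a \<Rightarrow> 'a \<Rightarrow> ennreal) \<Rightarrow> bool" where
  "extended_pseudo_distance A d \<longleftrightarrow>
     (\<forall>x \<in> A. \<forall>y \<in> A. d x y = d y x) \<and>
     (\<forall>x \<in> A. d x x = 0) \<and>
     (\<forall>x \<in> A. \<forall>y \<in> A. \<forall>z \<in> A. d x z \<le> d x y + d y z)"


section \<open>The connected intersection property and the relaxation constant\<close>

text \<open>Any two elements of \<open>S\<close> are joined by a finite zigzag of comparabilities inside \<open>S\<close>;
  this includes \<open>S = {}\<close>.\<close>

definition zigzag_connected :: "'u rel \<Rightarrow> 'u set \<Rightarrow> bool" where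
  "zigzag_connected P S \<longleftrightarrow> (\<forall>x \<in> S. \<forall>y \<in> S. (x, y) \<in> (Restr (P \<union> P\<inverse>) S)\<^sup>*)"

definition CIP :: "'u rel \<Rightarrow> ('u \<Rightarrow> 'u \<Rightarrow> ennreal) \<Rightarrow> bool" where
  "CIP P \<rho> \<longleftrightarrow>
     (\<forall>a \<in> Field P. \<forall>q \<in> Field P. \<forall>s \<ge> 0. \<forall>r \<ge> 0.
        zigzag_connected P (down P \<rho> s a \<inter> up P \<rho> r q))"

definition absdiff :: "ennreal \<Rightarrow> ennreal \<Rightarrow> ennreal" where
  "absdiff u v =
     (if u < \<infinity> \<and> v < \<infinity> then ennreal \<bar>enn2real u - enn2real v\<bar>
      else if u = \<infinity> \<and> v = \<infinity> then 0 else \<infinity>)"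

definition IV :: "'u rel \<Rightarrow> ('u \<Rightarrow> 'u \<Rightarrow> ennreal) \<Rightarrow> real \<Rightarrow> bool" where
  "IV P \<rho> c \<longleftrightarrow>
     (\<forall>a b. \<forall>t::real. (a, b) \<in> P \<longrightarrow> 0 \<le> t \<longrightarrow> ennreal t \<le> \<rho> a b \<longrightarrow>
        (\<exists>z. (a, z) \<in> P \<and> (z, b) \<in> P \<and>
             absdiff (\<rho> a z) (ennreal t) \<le> ennreal (c / 2) \<and>
             absdiff (\<rho> z b) (\<rho> a b - ennreal t) \<le> ennreal (c / 2)))"

definition c_rho :: "'u rel \<Rightarrow> ('u \<Rightarrow> 'u \<Rightarrow> ennreal) \<Rightarrow> ennreal" where
  "c_rho P \<rho> = Inf {ennreal c |c. c \<ge> 0 \<and> IV P \<rho> c}"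

end

theory Submission
  imports Defs
begin

text \<open>
  By the universal properties, a morphism \<open>p : M \<rightarrow> R\<^sub>r N\<close> is the same as a family of morphisms
  \<open>\<phi> x y : M x \<rightarrow> N y\<close>, indexed by the pairs \<open>x \<le> y\<close> of height difference at least \<open>r\<close>, that
  absorbs the structure maps of \<open>M\<close> and \<open>N\<close>; the equation \<open>e = q \<circ> p\<^sup>\<sharp>\<close> becomes
  \<open>\<psi> a y \<circ> \<phi> x a = M (x \<le> y)\<close>. Families of shifts \<open>s\<close> and \<open>r\<close> are composed through an intermediate
  point \<open>z\<close>, as \<open>\<phi>' z y \<circ> \<phi> x z\<close>: such a \<open>z\<close> exists if \<open>x\<close> and \<open>y\<close> differ by at least \<open>s + r + c\<close> and
  (IV\<open>\<^sub>c\<close>) holds, and by naturality the composite is constant along zigzags of points \<open>z\<close>, so that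
  it does not depend on \<open>z\<close> under the connected intersection property.
\<close>

section \<open>Posets as categories\<close>

lemma Ob_poset_cat [simp]: "Ob (poset_cat Q) = Field Q"
  and Idn_poset_cat [simp]: "Idn (poset_cat Q) a = (a, a)"
  and Comp_poset_cat [simp]: "Comp (poset_cat Q) g f = (fst f, snd g)"
  by (simp_all add: poset_cat_def)

lemma Hom_poset_cat [simp]: "f \<in> Hom (poset_cat Q) a b \<longleftrightarrow> f = (a, b) \<and> (a, b) \<in> Q"
  by (auto simp: poset_cat_def Hom_def)

lemma Ball_Hom_poset_cat [simp]: "(\<forall>f \<in> Hom (poset_cat Q) a b. R f) \<longleftrightarrow> ((a, b) \<in> Q \<longrightarrow> R (a, b))"
  by auto

lemma category_poset_cat:
  assumes "Preorder Q"
  shows "category (poset_cat Q)"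
proof -
  have "refl_on (Field Q) Q" "trans Q"
    using assms by (auto simp: preorder_on_def)
  then show ?thesis
    by unfold_locales
      (auto simp: poset_cat_def Hom_def FieldI1 FieldI2 dest: refl_onD elim: transD)
qed

text \<open>Arrows of \<open>poset_cat Q\<close> are the pairs in \<open>Q\<close>, so the functor
  laws become conditions on \<open>Q\<close> alone; the endpoints of such a pair lie in the field
  automatically.\<close>

lemma is_functor_poset_cat_iff:
  "is_functor (poset_cat Q) C M \<longleftrightarrow>
     (\<forall>a \<in> Field Q. fob M a \<in> Ob C \<and> far M (a, a) = Idn C (fob M a)) \<and>
     (\<forall>a b. (a, b) \<in> Q \<longrightarrow> far M (a, b) \<in> Hom C (fob M a) (fob M b)) \<and>
     (\<forall>a b c. (a, b) \<in> Q \<longrightarrow> (b, c) \<in> Q \<longrightarrow> far M (a, c) = Comp C (far M (b, c)) (far M (a, b)))"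
  unfolding is_functor_def by simp (blast intro: FieldI1 FieldI2)

text \<open>All conditions are universal over elements and comparable pairs, so they pass to a
  subrelation. Hence \<open>M\<close> itself serves as the diagram on every full subposet.\<close>

lemma is_functor_Restr:
  assumes "is_functor (poset_cat Q) C M"
  shows "is_functor (poset_cat (Restr Q S)) C M"
proof -
  have "Field (Restr Q S) \<subseteq> Field Q"
    by (auto simp: Field_def)
  with assms show ?thesis
    unfolding is_functor_poset_cat_iff by (simp add: subset_eq)
qed

section \<open>Chosen limits and colimits\<close>

lemma chosen_limit_is_limit:
  fixes J :: "('u, 'u \<times> 'u) cat"
  assumes "complete_category TYPE('u) C" "category J" "is_functor J C D"
  shows "is_limit J C D (fst (chosen_limit J C D)) (snd (chosen_limit J C D))"
proof -
  obtain X k where "is_limit J C D X k"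
    using assms unfolding complete_category_def by blast
  then have "\<exists>c. is_limit J C D (fst c) (snd c)"
    by (metis fst_conv snd_conv)
  then show ?thesis
    unfolding chosen_limit_def by (rule someI_ex)
qed

lemma chosen_colimit_is_colimit:
  fixes J :: "('u, 'u \<times> 'u) cat"
  assumes "cocomplete_category TYPE('u) C" "category J" "is_functor J C D"
  shows "is_colimit J C D (fst (chosen_colimit J C D)) (snd (chosen_colimit J C D))"
proof -
  obtain X k where "is_colimit J C D X k"
    using assms unfolding cocomplete_category_def by blast
  then have "\<exists>c. is_colimit J C D (fst c) (snd c)"
    by (metis fst_conv snd_conv)
  then show ?thesis
    unfolding chosen_colimit_def by (rule someI_ex)
qed

text \<open>The universal property supplies the unique existence that gives meaning to the definite
  description in \<open>lim_lift\<close>.\<close>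

lemma lim_lift:
  assumes "is_limit J C D (fst (chosen_limit J C D)) (snd (chosen_limit J C D))"
    and "is_cone J C D Y h"
  shows "lim_lift J C D Y h \<in> Hom C Y (fst (chosen_limit J C D))"
    and "\<And>i. i \<in> Ob J \<Longrightarrow> Comp C (snd (chosen_limit J C D) i) (lim_lift J C D Y h) = h i"
proof -
  have "\<exists>!u. u \<in> Hom C Y (fst (chosen_limit J C D)) \<and>
      (\<forall>i \<in> Ob J. Comp C (snd (chosen_limit J C D) i) u = h i)"
    using assms unfolding is_limit_def by blast
  from theI'[OF this]
  show "lim_lift J C D Y h \<in> Hom C Y (fst (chosen_limit J C D))"
    and "\<And>i. i \<in> Ob J \<Longrightarrow> Comp C (snd (chosen_limit J C D) i) (lim_lift J C D Y h) = h i"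
    unfolding lim_lift_def by auto
qed

lemma colim_desc:
  assumes "is_colimit J C D (fst (chosen_colimit J C D)) (snd (chosen_colimit J C D))"
    and "is_cocone J C D Y h"
  shows "colim_desc J C D Y h \<in> Hom C (fst (chosen_colimit J C D)) Y"
    and "\<And>i. i \<in> Ob J \<Longrightarrow> Comp C (colim_desc J C D Y h) (snd (chosen_colimit J C D) i) = h i"
proof -
  have "\<exists>!u. u \<in> Hom C (fst (chosen_colimit J C D)) Y \<and>
      (\<forall>i \<in> Ob J. Comp C u (snd (chosen_colimit J C D) i) = h i)"
    using assms unfolding is_colimit_def by blast
  from theI'[OF this]
  show "colim_desc J C D Y h \<in> Hom C (fst (chosen_colimit J C D)) Y"
    and "\<And>i. i \<in> Ob J \<Longrightarrow> Comp C (colim_desc J C D Y h) (snd (chosen_colimit J C D) i) = h i"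
    unfolding colim_desc_def by auto
qed

text \<open>The legs composed with \<open>v\<close> form a cone on \<open>Y\<close>, and both
  \<open>u\<close> and \<open>v\<close> are mediating morphisms for it.\<close>

lemma (in category) is_limit_jointly_monic:
  assumes lim: "is_limit J C D X k"
    and u: "u \<in> Hom C Y X" and v: "v \<in> Hom C Y X"
    and eq: "\<And>i. i \<in> Ob J \<Longrightarrow> Comp C (k i) u = Comp C (k i) v"
    and D: "is_functor J C D"
  shows "u = v"
proof -
  have cone: "is_cone J C D X k"
    using lim by (simp add: is_limit_def)
  have "is_cone J C D Y (\<lambda>i. Comp C (k i) v)"
    unfolding is_cone_def
  proof (intro conjI ballI)
    show "Y \<in> Ob C"
      using v dom_in by (auto simp: Hom_def)
  next
    fix i assume "i \<in> Ob J"
    then show "Comp C (k i) v \<in> Hom C Y (fob D i)"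
      using cone v comp_in unfolding is_cone_def by blast
  next
    fix i j f assume *: "i \<in> Ob J" "j \<in> Ob J" "f \<in> Hom J i j"
    then have "k i \<in> Hom C X (fob D i)" "far D f \<in> Hom C (fob D i) (fob D j)"
      "Comp C (far D f) (k i) = k j"
      using cone D unfolding is_cone_def is_functor_def by blast+
    then show "Comp C (far D f) (Comp C (k i) v) = Comp C (k j) v"
      using comp_assoc v by metis
  qed
  then have "\<exists>!w. w \<in> Hom C Y X \<and> (\<forall>i \<in> Ob J. Comp C (k i) w = Comp C (k i) v)"
    using lim unfolding is_limit_def by blast
  then show ?thesis
    using u v eq by blast
qed

text \<open>Dual argument: \<open>v\<close> composed with the legs is a cocone, through which both
  \<open>u\<close> and \<open>v\<close> factor.\<close>

lemma (in category) is_colimit_jointly_epic: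
  assumes colim: "is_colimit J C D X k"
    and u: "u \<in> Hom C X Y" and v: "v \<in> Hom C X Y"
    and eq: "\<And>i. i \<in> Ob J \<Longrightarrow> Comp C u (k i) = Comp C v (k i)"
    and D: "is_functor J C D"
  shows "u = v"
proof -
  have cocone: "is_cocone J C D X k"
    using colim by (simp add: is_colimit_def)
  have "is_cocone J C D Y (\<lambda>i. Comp C v (k i))"
    unfolding is_cocone_def
  proof (intro conjI ballI)
    show "Y \<in> Ob C"
      using v cod_in by (auto simp: Hom_def)
  next
    fix i assume "i \<in> Ob J"
    then show "Comp C v (k i) \<in> Hom C (fob D i) Y"
      using cocone v comp_in unfolding is_cocone_def by blast
  next
    fix i j f assume *: "i \<in> Ob J" "j \<in> Ob J" "f \<in> Hom J i j"
    then have "k j \<in> Hom C (fob D j) X" "far D f \<in> Hom C (fob D i) (fob D j)"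
      "Comp C (k j) (far D f) = k i"
      using cocone D unfolding is_cocone_def is_functor_def by blast+
    then show "Comp C (Comp C v (k j)) (far D f) = Comp C v (k i)"
      using comp_assoc v by metis
  qed
  then have "\<exists>!w. w \<in> Hom C X Y \<and> (\<forall>i \<in> Ob J. Comp C w (k i) = Comp C v (k i))"
    using colim unfolding is_colimit_def by blast
  then show ?thesis
    using u v eq by blast
qed

section \<open>Interleavings as families of morphisms\<close>

locale height_poset = category C
  for C :: "('o, 'm) cat" +
  fixes P :: "'u rel" and \<rho> :: "'u \<Rightarrow> 'u \<Rightarrow> ennreal"
  assumes partial_order: "Partial_order P"
    and height_diff: "height_difference P \<rho>"
    and complete: "complete_category TYPE('u) C"
    and cocomplete: "cocomplete_category TYPE('u) C"
begin

text \<open>One relation for both memberships: \<open>x\<close> lies in the down-set of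
  \<open>y\<close> iff \<open>y\<close> lies in the up-set of \<open>x\<close>. This symmetry
  underlies the adjunction between \<open>L_fun\<close> and \<open>R_fun\<close>.\<close>

definition gap :: "real \<Rightarrow> 'u \<Rightarrow> 'u \<Rightarrow> bool" where
  "gap r x y \<longleftrightarrow> (x, y) \<in> P \<and> ennreal r \<le> \<rho> x y"

lemma mem_down [simp]: "x \<in> down P \<rho> r y \<longleftrightarrow> gap r x y"
  and mem_up [simp]: "y \<in> up P \<rho> r x \<longleftrightarrow> gap r x y"
  by (auto simp: down_def up_def gap_def)

lemma P_refl: "a \<in> Field P \<Longrightarrow> (a, a) \<in> P"
  using partial_order by (auto simp: partial_order_on_def preorder_on_def dest: refl_onD)

lemma P_trans: "(a, b) \<in> P \<Longrightarrow> (b, c) \<in> P \<Longrightarrow> (a, c) \<in> P"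
  using partial_order by (auto simp: partial_order_on_def preorder_on_def dest: transD)

lemma gapD: "gap r x y \<Longrightarrow> (x, y) \<in> P"
  by (simp add: gap_def)

lemma gap_Field: "gap r x y \<Longrightarrow> x \<in> Field P" "gap r x y \<Longrightarrow> y \<in> Field P"
  by (auto simp: gap_def FieldI1 FieldI2)

lemma height_diff_add: "(a, b) \<in> P \<Longrightarrow> (b, c) \<in> P \<Longrightarrow> \<rho> a b + \<rho> b c \<le> \<rho> a c"
  using height_diff unfolding height_difference_def by blast

text \<open>By superadditivity and nonnegativity of \<rho>, raising the upper end cannot decrease
  the height difference; below, the same for lowering the lower end.\<close>

lemma gap_trans1: "gap r x y \<Longrightarrow> (y, z) \<in> P \<Longrightarrow> gap r x z"
  unfolding gap_def by (meson P_trans height_diff_add add_increasing2 order_trans zero_le le_iff_add)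

lemma gap_trans2: "(x, y) \<in> P \<Longrightarrow> gap r y z \<Longrightarrow> gap r x z"
  unfolding gap_def
  by (metis P_trans height_diff_add add.commute le_iff_add order_trans)

text \<open>By reflexivity no element is lost from the field under restriction, so the objects of
  \<open>down_cat\<close> and \<open>up_cat\<close> are exactly the elements of these sets.\<close>

lemma Field_Restr_down [simp]: "Field (Restr P (down P \<rho> r a)) = down P \<rho> r a"
  and Field_Restr_up [simp]: "Field (Restr P (up P \<rho> r a)) = up P \<rho> r a"
proof -
  have "Refl P"
    using partial_order by (simp add: partial_order_on_def preorder_on_def)
  moreover have "down P \<rho> r a \<subseteq> Field P" "up P \<rho> r a \<subseteq> Field P"
    by (auto intro: gap_Field)
  ultimately show "Field (Restr P (down P \<rho> r a)) = down P \<rho> r a"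
    and "Field (Restr P (up P \<rho> r a)) = up P \<rho> r a"
    by (simp_all add: Refl_Field_Restr2)
qed

lemma category_Restr: "category (poset_cat (Restr P S))"
proof -
  have "Partial_order (Restr P S)"
    using partial_order by (rule Partial_order_Restr)
  then show ?thesis
    by (simp add: category_poset_cat partial_order_on_def)
qed

section \<open>Cones, cocones and chosen (co)limits over up-sets and down-sets\<close>

lemma far_in: "M \<in> Fun P C \<Longrightarrow> (a, b) \<in> P \<Longrightarrow> far M (a, b) \<in> Hom C (fob M a) (fob M b)"
  and far_comp: "M \<in> Fun P C \<Longrightarrow> (a, b) \<in> P \<Longrightarrow> (b, c) \<in> P \<Longrightarrow>
    Comp C (far M (b, c)) (far M (a, b)) = far M (a, c)"
  and fob_in: "M \<in> Fun P C \<Longrightarrow> a \<in> Field P \<Longrightarrow> fob M a \<in> Ob C"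
  by (simp_all add: Fun_def is_functor_poset_cat_iff)

text \<open>Up-sets are closed upwards, so the target of an arrow that starts in one needs no
  separate membership condition.\<close>

lemma is_cone_up_iff:
  "is_cone (up_cat P \<rho> r a) C M Y h \<longleftrightarrow>
     Y \<in> Ob C \<and> (\<forall>y. gap r a y \<longrightarrow> h y \<in> Hom C Y (fob M y)) \<and>
     (\<forall>y z. gap r a y \<longrightarrow> (y, z) \<in> P \<longrightarrow> Comp C (far M (y, z)) (h y) = h z)"
  unfolding is_cone_def by (simp add: Ball_def) (blast intro: gap_trans1)

lemma is_cocone_down_iff:
  "is_cocone (down_cat P \<rho> r a) C M Y h \<longleftrightarrow>
     Y \<in> Ob C \<and> (\<forall>x. gap r x a \<longrightarrow> h x \<in> Hom C (fob M x) Y) \<and>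
     (\<forall>x z. (x, z) \<in> P \<longrightarrow> gap r z a \<longrightarrow> Comp C (h z) (far M (x, z)) = h x)"
  unfolding is_cocone_def by (simp add: Ball_def) (blast intro: gap_trans2)

lemma fob_L_fun: "fob (L_fun P \<rho> C r M) a = fst (chosen_colimit (down_cat P \<rho> r a) C M)"
  and fob_R_fun: "fob (R_fun P \<rho> C r M) a = fst (chosen_limit (up_cat P \<rho> r a) C M)"
  by (simp_all add: L_fun_def R_fun_def)

lemma lim_R:
  assumes "M \<in> Fun P C"
  shows "is_limit (up_cat P \<rho> r a) C M (fob (R_fun P \<rho> C r M) a) (lim_proj P \<rho> C r M a)"
  using assms chosen_limit_is_limit[OF complete category_Restr is_functor_Restr]
  by (simp add: Fun_def fob_R_fun lim_proj_def)

lemma colim_L: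
  assumes "M \<in> Fun P C"
  shows "is_colimit (down_cat P \<rho> r a) C M (fob (L_fun P \<rho> C r M) a) (colim_inj P \<rho> C r M a)"
  using assms chosen_colimit_is_colimit[OF cocomplete category_Restr is_functor_Restr]
  by (simp add: Fun_def fob_L_fun colim_inj_def)

lemma
  assumes "M \<in> Fun P C"
  shows R_fun_in: "fob (R_fun P \<rho> C r M) a \<in> Ob C"
    and lim_proj_in: "gap r a y \<Longrightarrow>
      lim_proj P \<rho> C r M a y \<in> Hom C (fob (R_fun P \<rho> C r M) a) (fob M y)"
    and lim_proj_far: "gap r a y \<Longrightarrow> (y, z) \<in> P \<Longrightarrow>
      Comp C (far M (y, z)) (lim_proj P \<rho> C r M a y) = lim_proj P \<rho> C r M a z"
  using lim_R[OF assms, of r a] unfolding is_limit_def is_cone_up_iff by auto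

lemma
  assumes "M \<in> Fun P C"
  shows colim_inj_in: "gap r x a \<Longrightarrow>
    colim_inj P \<rho> C r M a x \<in> Hom C (fob M x) (fob (L_fun P \<rho> C r M) a)"
  using colim_L[OF assms, of r a] unfolding is_colimit_def is_cocone_down_iff by auto

lemma
  assumes "M \<in> Fun P C" "is_cone (up_cat P \<rho> r a) C M Y h"
  shows lim_lift_up_in: "lim_lift (up_cat P \<rho> r a) C M Y h \<in> Hom C Y (fob (R_fun P \<rho> C r M) a)"
    and lim_proj_lift: "gap r a y \<Longrightarrow>
      Comp C (lim_proj P \<rho> C r M a y) (lim_lift (up_cat P \<rho> r a) C M Y h) = h y"
  using lim_lift[OF _ assms(2)] lim_R[OF assms(1)] by (auto simp: fob_R_fun lim_proj_def)

lemma
  assumes "M \<in> Fun P C" "is_cocone (down_cat P \<rho> r a) C M Y h"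
  shows colim_desc_down_in:
      "colim_desc (down_cat P \<rho> r a) C M Y h \<in> Hom C (fob (L_fun P \<rho> C r M) a) Y"
    and colim_inj_desc: "gap r x a \<Longrightarrow>
      Comp C (colim_desc (down_cat P \<rho> r a) C M Y h) (colim_inj P \<rho> C r M a x) = h x"
  using colim_desc[OF _ assms(2)] colim_L[OF assms(1)] by (auto simp: fob_L_fun colim_inj_def)

lemma R_fun_eqI:
  assumes "M \<in> Fun P C"
    and "u \<in> Hom C Y (fob (R_fun P \<rho> C r M) a)" "v \<in> Hom C Y (fob (R_fun P \<rho> C r M) a)"
    and "\<And>y. gap r a y \<Longrightarrow> Comp C (lim_proj P \<rho> C r M a y) u = Comp C (lim_proj P \<rho> C r M a y) v"
  shows "u = v"
  using is_limit_jointly_monic[OF lim_R[OF assms(1)] assms(2,3)] assms(1,4)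
  by (simp add: Fun_def is_functor_Restr)

lemma L_fun_eqI:
  assumes "M \<in> Fun P C"
    and "u \<in> Hom C (fob (L_fun P \<rho> C r M) a) Y" "v \<in> Hom C (fob (L_fun P \<rho> C r M) a) Y"
    and "\<And>x. gap r x a \<Longrightarrow> Comp C u (colim_inj P \<rho> C r M a x) = Comp C v (colim_inj P \<rho> C r M a x)"
  shows "u = v"
  using is_colimit_jointly_epic[OF colim_L[OF assms(1)] assms(2,3)] assms(1,4)
  by (simp add: Fun_def is_functor_Restr)

lemma
  assumes M: "M \<in> Fun P C" and ab: "(a, b) \<in> P"
  shows far_R_fun_in: "far (R_fun P \<rho> C r M) (a, b) \<in>
      Hom C (fob (R_fun P \<rho> C r M) a) (fob (R_fun P \<rho> C r M) b)"
    and lim_proj_far_R_fun: "gap r b y \<Longrightarrow>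
      Comp C (lim_proj P \<rho> C r M b y) (far (R_fun P \<rho> C r M) (a, b)) = lim_proj P \<rho> C r M a y"
proof -
  \<comment> \<open>The up-set of \<open>b\<close> is contained in that of \<open>a\<close>, so the
    limit cone at \<open>a\<close> restricts to it.\<close>
  have cone: "is_cone (up_cat P \<rho> r b) C M (fob (R_fun P \<rho> C r M) a) (lim_proj P \<rho> C r M a)"
    using M ab by (auto simp: is_cone_up_iff R_fun_in lim_proj_in lim_proj_far gap_trans2)
  have far: "far (R_fun P \<rho> C r M) (a, b) =
      lim_lift (up_cat P \<rho> r b) C M (fob (R_fun P \<rho> C r M) a) (lim_proj P \<rho> C r M a)"
    by (simp add: R_fun_def)
  show "far (R_fun P \<rho> C r M) (a, b) \<in>
      Hom C (fob (R_fun P \<rho> C r M) a) (fob (R_fun P \<rho> C r M) b)"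
    unfolding far using M cone by (rule lim_lift_up_in)
  show "Comp C (lim_proj P \<rho> C r M b y) (far (R_fun P \<rho> C r M) (a, b)) = lim_proj P \<rho> C r M a y"
    if "gap r b y"
    unfolding far using M cone that by (rule lim_proj_lift)
qed

text \<open>For fixed \<open>x\<close> the first two clauses make \<open>\<phi> x\<close> a cone
  over the up-set of \<open>x\<close>, that is, a morphism into \<open>R_fun\<close>; dually, the
  first and third make \<phi> a cocone for fixed upper end, a morphism out of \<open>L_fun\<close>.
  The form is symmetric under the adjunction.\<close>

definition shift_family ::
  "real \<Rightarrow> ('u, 'u \<times> 'u, 'o, 'm) func \<Rightarrow> ('u, 'u \<times> 'u, 'o, 'm) func \<Rightarrow> ('u \<Rightarrow> 'u \<Rightarrow> 'm) \<Rightarrow> bool"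
  where "shift_family r M N \<phi> \<longleftrightarrow>
     (\<forall>x y. gap r x y \<longrightarrow> \<phi> x y \<in> Hom C (fob M x) (fob N y)) \<and>
     (\<forall>x y z. gap r x y \<longrightarrow> (y, z) \<in> P \<longrightarrow> Comp C (far N (y, z)) (\<phi> x y) = \<phi> x z) \<and>
     (\<forall>x y z. (x, y) \<in> P \<longrightarrow> gap r y z \<longrightarrow> Comp C (\<phi> y z) (far M (x, y)) = \<phi> x z)"

text \<open>This is one of the two interleaving equations, read between a colimit injection at
  \<open>x\<close> and a limit projection at \<open>y\<close>; the other arises by exchanging \<phi>
  and \<psi>.\<close>

definition inverse_shifts ::
  "real \<Rightarrow> ('u, 'u \<times> 'u, 'o, 'm) func \<Rightarrow> ('u \<Rightarrow> 'u \<Rightarrow> 'm) \<Rightarrow> ('u \<Rightarrow> 'u \<Rightarrow> 'm) \<Rightarrow> bool"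
  where "inverse_shifts r M \<phi> \<psi> \<longleftrightarrow>
     (\<forall>x a y. gap r x a \<longrightarrow> gap r a y \<longrightarrow> Comp C (\<psi> a y) (\<phi> x a) = far M (x, y))"

lemma
  assumes "shift_family r M N \<phi>"
  shows shift_in: "gap r x y \<Longrightarrow> \<phi> x y \<in> Hom C (fob M x) (fob N y)"
    and far_shift: "gap r x y \<Longrightarrow> (y, z) \<in> P \<Longrightarrow> Comp C (far N (y, z)) (\<phi> x y) = \<phi> x z"
    and shift_far: "(x, y) \<in> P \<Longrightarrow> gap r y z \<Longrightarrow> Comp C (\<phi> y z) (far M (x, y)) = \<phi> x z"
  using assms unfolding shift_family_def by blast+

abbreviation components ::
  "real \<Rightarrow> ('u, 'u \<times> 'u, 'o, 'm) func \<Rightarrow> ('u \<Rightarrow> 'm) \<Rightarrow> 'u \<Rightarrow> 'u \<Rightarrow> 'm"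
  where "components r N p x y \<equiv> Comp C (lim_proj P \<rho> C r N x y) (p x)"

lemma nat_trans_R_fun_iff:
  "is_nat_trans (poset_cat P) C M (R_fun P \<rho> C r N) p \<longleftrightarrow>
     (\<forall>a \<in> Field P. p a \<in> Hom C (fob M a) (fob (R_fun P \<rho> C r N) a)) \<and>
     (\<forall>a b. (a, b) \<in> P \<longrightarrow> Comp C (p b) (far M (a, b)) = Comp C (far (R_fun P \<rho> C r N) (a, b)) (p a))"
  unfolding is_nat_trans_def by simp (blast intro: FieldI1 FieldI2)

text \<open>Absorption of the maps of \<open>N\<close> is the cone condition on the projections.
  Absorption of the maps of \<open>M\<close> combines naturality of \<open>p\<close> with the
  compatibility of projections with the structure maps of \<open>R_fun\<close>.\<close>

lemma shift_family_components:
  assumes M: "M \<in> Fun P C" and N: "N \<in> Fun P C"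
    and p: "is_nat_trans (poset_cat P) C M (R_fun P \<rho> C r N) p"
  shows "shift_family r M N (components r N p)"
proof -
  have p_in: "p a \<in> Hom C (fob M a) (fob (R_fun P \<rho> C r N) a)" if "a \<in> Field P" for a
    using p that by (simp add: nat_trans_R_fun_iff)
  have p_nat: "Comp C (p b) (far M (a, b)) = Comp C (far (R_fun P \<rho> C r N) (a, b)) (p a)"
    if "(a, b) \<in> P" for a b
    using p that by (simp add: nat_trans_R_fun_iff)
  show ?thesis
    unfolding shift_family_def
  proof (intro conjI allI impI)
    fix x y assume "gap r x y"
    then show "components r N p x y \<in> Hom C (fob M x) (fob N y)"
      using p_in lim_proj_in[OF N] comp_in gap_Field by meson
  next
    fix x y z assume *: "gap r x y" "(y, z) \<in> P"
    then show "Comp C (far N (y, z)) (components r N p x y) = components r N p x z"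
      using comp_assoc[OF p_in lim_proj_in[OF N] far_in[OF N]] lim_proj_far[OF N] gap_Field
      by metis
  next
    fix x y z assume *: "(x, y) \<in> P" "gap r y z"
    then have F: "x \<in> Field P" "y \<in> Field P"
      by (auto simp: FieldI1 FieldI2)
    have "Comp C (components r N p y z) (far M (x, y)) =
        Comp C (lim_proj P \<rho> C r N y z) (Comp C (p y) (far M (x, y)))"
      using * F by (metis comp_assoc far_in[OF M] p_in lim_proj_in[OF N])
    also have "\<dots> = Comp C (Comp C (lim_proj P \<rho> C r N y z) (far (R_fun P \<rho> C r N) (x, y))) (p x)"
      using * F by (metis p_nat comp_assoc far_R_fun_in[OF N] p_in lim_proj_in[OF N])
    also have "\<dots> = components r N p x z"
      using * by (simp add: lim_proj_far_R_fun[OF N])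
    finally show "Comp C (components r N p y z) (far M (x, y)) = components r N p x z" .
  qed
qed

text \<open>Each \<open>\<phi> x\<close> is a cone and hence induces \<open>p x\<close>; naturality
  can be tested after composing with the jointly monic projections, where both sides become
  \<open>\<phi> a y\<close>.\<close>

lemma nat_trans_of_shift_family:
  assumes M: "M \<in> Fun P C" and N: "N \<in> Fun P C" and \<phi>: "shift_family r M N \<phi>"
  obtains p where "is_nat_trans (poset_cat P) C M (R_fun P \<rho> C r N) p"
    and "\<And>x y. gap r x y \<Longrightarrow> components r N p x y = \<phi> x y"
proof -
  define p where "p x = lim_lift (up_cat P \<rho> r x) C N (fob M x) (\<phi> x)" for x
  have cone: "is_cone (up_cat P \<rho> r x) C N (fob M x) (\<phi> x)" if "x \<in> Field P" for x
    using that by (auto simp: is_cone_up_iff fob_in[OF M] shift_in[OF \<phi>] far_shift[OF \<phi>])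
  have p_in: "p x \<in> Hom C (fob M x) (fob (R_fun P \<rho> C r N) x)" if "x \<in> Field P" for x
    unfolding p_def using N cone[OF that] by (rule lim_lift_up_in)
  have p_comp: "components r N p x y = \<phi> x y" if "gap r x y" for x y
    unfolding p_def using N cone that gap_Field by (blast intro: lim_proj_lift)
  have "Comp C (p b) (far M (a, b)) = Comp C (far (R_fun P \<rho> C r N) (a, b)) (p a)"
    if ab: "(a, b) \<in> P" for a b
  proof (rule R_fun_eqI[OF N])
    have F: "a \<in> Field P" "b \<in> Field P"
      using ab by (auto simp: FieldI1 FieldI2)
    show "Comp C (p b) (far M (a, b)) \<in> Hom C (fob M a) (fob (R_fun P \<rho> C r N) b)"
      using far_in[OF M ab] p_in[OF F(2)] by (rule comp_in)
    show "Comp C (far (R_fun P \<rho> C r N) (a, b)) (p a) \<in> Hom C (fob M a) (fob (R_fun P \<rho> C r N) b)"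
      using p_in[OF F(1)] far_R_fun_in[OF N ab] by (rule comp_in)
    fix y assume y: "gap r b y"
    have "Comp C (lim_proj P \<rho> C r N b y) (Comp C (p b) (far M (a, b))) = \<phi> a y"
      by (simp add: comp_assoc[OF far_in[OF M ab] p_in[OF F(2)] lim_proj_in[OF N y]]
          p_comp[OF y] shift_far[OF \<phi> ab y])
    also have "\<dots> = Comp C (lim_proj P \<rho> C r N b y) (Comp C (far (R_fun P \<rho> C r N) (a, b)) (p a))"
      by (simp add: comp_assoc[OF p_in[OF F(1)] far_R_fun_in[OF N ab] lim_proj_in[OF N y]]
          p_comp[OF gap_trans2[OF ab y]] lim_proj_far_R_fun[OF N ab y])
    finally show "Comp C (lim_proj P \<rho> C r N b y) (Comp C (p b) (far M (a, b))) =
      Comp C (lim_proj P \<rho> C r N b y) (Comp C (far (R_fun P \<rho> C r N) (a, b)) (p a))" .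
  qed
  with p_in have "is_nat_trans (poset_cat P) C M (R_fun P \<rho> C r N) p"
    by (simp add: nat_trans_R_fun_iff)
  with p_comp show thesis
    using that by blast
qed

section \<open>Matrix entries of the unit maps, the adjoint and \<open>e_mor\<close>\<close>

lemma
  assumes M: "M \<in> Fun P C" and a: "a \<in> Field P"
  shows eta_R_in: "eta_R P \<rho> C r M a \<in> Hom C (fob M a) (fob (R_fun P \<rho> C r M) a)"
    and lim_proj_eta_R: "gap r a y \<Longrightarrow>
      Comp C (lim_proj P \<rho> C r M a y) (eta_R P \<rho> C r M a) = far M (a, y)"
proof -
  have cone: "is_cone (up_cat P \<rho> r a) C M (fob M a) (\<lambda>y. far M (a, y))"
    using a by (auto simp: is_cone_up_iff fob_in[OF M] far_in[OF M] far_comp[OF M] dest: gapD)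
  show "eta_R P \<rho> C r M a \<in> Hom C (fob M a) (fob (R_fun P \<rho> C r M) a)"
    unfolding eta_R_def using M cone by (rule lim_lift_up_in)
  show "Comp C (lim_proj P \<rho> C r M a y) (eta_R P \<rho> C r M a) = far M (a, y)" if "gap r a y"
    unfolding eta_R_def using M cone that by (rule lim_proj_lift)
qed

lemma
  assumes M: "M \<in> Fun P C" and a: "a \<in> Field P"
  shows eta_L_in: "eta_L P \<rho> C r M a \<in> Hom C (fob (L_fun P \<rho> C r M) a) (fob M a)"
    and eta_L_colim_inj: "gap r x a \<Longrightarrow>
      Comp C (eta_L P \<rho> C r M a) (colim_inj P \<rho> C r M a x) = far M (x, a)"
proof -
  have cocone: "is_cocone (down_cat P \<rho> r a) C M (fob M a) (\<lambda>x. far M (x, a))"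
    using a by (auto simp: is_cocone_down_iff fob_in[OF M] far_in[OF M] far_comp[OF M] dest: gapD)
  show "eta_L P \<rho> C r M a \<in> Hom C (fob (L_fun P \<rho> C r M) a) (fob M a)"
    unfolding eta_L_def using M cocone by (rule colim_desc_down_in)
  show "Comp C (eta_L P \<rho> C r M a) (colim_inj P \<rho> C r M a x) = far M (x, a)" if "gap r x a"
    unfolding eta_L_def using M cocone that by (rule colim_inj_desc)
qed

text \<open>The third clause of \<open>shift_family\<close> is the cocone condition, so the adjoint
  has the same components as \<open>p\<close>, now read along colimit injections.\<close>

lemma
  assumes M: "M \<in> Fun P C" and N: "N \<in> Fun P C" and a: "a \<in> Field P"
    and p: "is_nat_trans (poset_cat P) C M (R_fun P \<rho> C r N) p"
  shows sharp_in: "sharp P \<rho> C r M N p a \<in> Hom C (fob (L_fun P \<rho> C r M) a) (fob N a)"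
    and sharp_colim_inj: "gap r x a \<Longrightarrow>
      Comp C (sharp P \<rho> C r M N p a) (colim_inj P \<rho> C r M a x) = components r N p x a"
proof -
  note \<phi> = shift_family_components[OF M N p]
  have cocone: "is_cocone (down_cat P \<rho> r a) C M (fob N a) (\<lambda>x. components r N p x a)"
    using a by (auto simp: is_cocone_down_iff fob_in[OF N] shift_in[OF \<phi>] shift_far[OF \<phi>])
  show "sharp P \<rho> C r M N p a \<in> Hom C (fob (L_fun P \<rho> C r M) a) (fob N a)"
    unfolding sharp_def using M cocone by (rule colim_desc_down_in)
  show "Comp C (sharp P \<rho> C r M N p a) (colim_inj P \<rho> C r M a x) = components r N p x a"
    if "gap r x a"
    unfolding sharp_def using M cocone that by (rule colim_inj_desc)
qed

text \<open>A morphism from a colimit to a limit is determined by its composites with injections and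
  projections. The entry of \<open>e_mor\<close> at \<open>x\<close>, \<open>y\<close> is the
  structure map of \<open>M\<close>, while that of the composite is the product of the components of
  \<open>q\<close> and \<open>p\<close>.\<close>

lemma e_mor_eq_iff:
  assumes M: "M \<in> Fun P C" and N: "N \<in> Fun P C"
    and p: "is_nat_trans (poset_cat P) C M (R_fun P \<rho> C r N) p"
    and q: "is_nat_trans (poset_cat P) C N (R_fun P \<rho> C r M) q"
  shows "(\<forall>a \<in> Field P. e_mor P \<rho> C r M a = Comp C (q a) (sharp P \<rho> C r M N p a)) \<longleftrightarrow>
    inverse_shifts r M (components r N p) (components r M q)"
proof -
  \<comment> \<open>Reassociation lets the projection meet \<open>v\<close> and the injection meet
    \<open>u\<close>, so that each factor is evaluated separately.\<close>
  have sandwich: "Comp C (lim_proj P \<rho> C r M a y) (Comp C (Comp C v u) (colim_inj P \<rho> C r M a x)) =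
      Comp C (Comp C (lim_proj P \<rho> C r M a y) v) (Comp C u (colim_inj P \<rho> C r M a x))"
    if "gap r x a" "gap r a y" "u \<in> Hom C (fob (L_fun P \<rho> C r M) a) Z"
      "v \<in> Hom C Z (fob (R_fun P \<rho> C r M) a)" for x a y u v Z
    using that colim_inj_in[OF M that(1)] lim_proj_in[OF M that(2)] by (metis comp_assoc comp_in)
  have q_in: "q a \<in> Hom C (fob N a) (fob (R_fun P \<rho> C r M) a)" if "a \<in> Field P" for a
    using q that by (simp add: nat_trans_R_fun_iff)
  have e_comp: "Comp C (lim_proj P \<rho> C r M a y) (Comp C (e_mor P \<rho> C r M a) (colim_inj P \<rho> C r M a x))
      = far M (x, y)" if "gap r x a" "gap r a y" for x a y
    unfolding e_mor_def
    using that by (simp add: sandwich[OF that eta_L_in[OF M] eta_R_in[OF M]] gap_Field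
        eta_L_colim_inj[OF M] lim_proj_eta_R[OF M] far_comp[OF M] gapD)
  have qp_comp: "Comp C (lim_proj P \<rho> C r M a y)
      (Comp C (Comp C (q a) (sharp P \<rho> C r M N p a)) (colim_inj P \<rho> C r M a x))
      = Comp C (components r M q a y) (components r N p x a)" if "gap r x a" "gap r a y" for x a y
    using that by (simp add: sandwich[OF that sharp_in[OF M N _ p] q_in] gap_Field
        sharp_colim_inj[OF M N _ p])
  show ?thesis
  proof
    assume "\<forall>a \<in> Field P. e_mor P \<rho> C r M a = Comp C (q a) (sharp P \<rho> C r M N p a)"
    then show "inverse_shifts r M (components r N p) (components r M q)"
      unfolding inverse_shifts_def using e_comp qp_comp gap_Field by metis
  next
    assume inv: "inverse_shifts r M (components r N p) (components r M q)"
    show "\<forall>a \<in> Field P. e_mor P \<rho> C r M a = Comp C (q a) (sharp P \<rho> C r M N p a)"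
    proof
      fix a assume a: "a \<in> Field P"
      let ?L = "fob (L_fun P \<rho> C r M) a" and ?R = "fob (R_fun P \<rho> C r M) a"
      have e: "e_mor P \<rho> C r M a \<in> Hom C ?L ?R"
        unfolding e_mor_def using eta_L_in[OF M a] eta_R_in[OF M a] by (rule comp_in)
      have qp: "Comp C (q a) (sharp P \<rho> C r M N p a) \<in> Hom C ?L ?R"
        using sharp_in[OF M N a p] q_in[OF a] by (rule comp_in)
      show "e_mor P \<rho> C r M a = Comp C (q a) (sharp P \<rho> C r M N p a)"
      proof (rule L_fun_eqI[OF M e qp])
        fix x assume x: "gap r x a"
        show "Comp C (e_mor P \<rho> C r M a) (colim_inj P \<rho> C r M a x) =
          Comp C (Comp C (q a) (sharp P \<rho> C r M N p a)) (colim_inj P \<rho> C r M a x)"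
          using inv x
          by (intro R_fun_eqI[OF M comp_in[OF colim_inj_in[OF M x] e]
                comp_in[OF colim_inj_in[OF M x] qp]])
            (simp add: e_comp qp_comp inverse_shifts_def)
      qed
    qed
  qed
qed

theorem height_interleaved_iff:
  assumes M: "M \<in> Fun P C" and N: "N \<in> Fun P C"
  shows "height_interleaved P \<rho> C r M N \<longleftrightarrow>
    (\<exists>\<phi> \<psi>. shift_family r M N \<phi> \<and> shift_family r N M \<psi> \<and>
       inverse_shifts r M \<phi> \<psi> \<and> inverse_shifts r N \<psi> \<phi>)"
proof
  assume "height_interleaved P \<rho> C r M N"
  then obtain p q where p: "is_nat_trans (poset_cat P) C M (R_fun P \<rho> C r N) p"
    and q: "is_nat_trans (poset_cat P) C N (R_fun P \<rho> C r M) q"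
    and "\<forall>a \<in> Field P. e_mor P \<rho> C r M a = Comp C (q a) (sharp P \<rho> C r M N p a)"
    and "\<forall>a \<in> Field P. e_mor P \<rho> C r N a = Comp C (p a) (sharp P \<rho> C r N M q a)"
    unfolding height_interleaved_def by blast
  then show "\<exists>\<phi> \<psi>. shift_family r M N \<phi> \<and> shift_family r N M \<psi> \<and>
       inverse_shifts r M \<phi> \<psi> \<and> inverse_shifts r N \<psi> \<phi>"
    using shift_family_components[OF M N p] shift_family_components[OF N M q]
      e_mor_eq_iff[OF M N p q] e_mor_eq_iff[OF N M q p] by blast
next
  assume "\<exists>\<phi> \<psi>. shift_family r M N \<phi> \<and> shift_family r N M \<psi> \<and>
       inverse_shifts r M \<phi> \<psi> \<and> inverse_shifts r N \<psi> \<phi>"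
  then obtain \<phi> \<psi> where \<phi>: "shift_family r M N \<phi>" and \<psi>: "shift_family r N M \<psi>"
    and inv: "inverse_shifts r M \<phi> \<psi>" "inverse_shifts r N \<psi> \<phi>"
    by blast
  obtain p where p: "is_nat_trans (poset_cat P) C M (R_fun P \<rho> C r N) p"
    and p_comp: "\<And>x y. gap r x y \<Longrightarrow> components r N p x y = \<phi> x y"
    using nat_trans_of_shift_family[OF M N \<phi>] by blast
  obtain q where q: "is_nat_trans (poset_cat P) C N (R_fun P \<rho> C r M) q"
    and q_comp: "\<And>x y. gap r x y \<Longrightarrow> components r M q x y = \<psi> x y"
    using nat_trans_of_shift_family[OF N M \<psi>] by blast
  \<comment> \<open>Agreement of components with \<phi> and \<psi> on pairs with a gap suffices,
    since \<open>inverse_shifts\<close> evaluates them only there.\<close>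
  have "inverse_shifts r M (components r N p) (components r M q)"
    "inverse_shifts r N (components r M q) (components r N p)"
    using inv p_comp q_comp by (simp_all add: inverse_shifts_def)
  then show "height_interleaved P \<rho> C r M N"
    unfolding height_interleaved_def
    using p q e_mor_eq_iff[OF M N p q] e_mor_eq_iff[OF N M q p] by blast
qed

section \<open>Composition of interleavings\<close>

text \<open>The structure maps of \<open>M\<close> form a shift family that is inverse to
  itself.\<close>

lemma height_interleaved_refl:
  assumes M: "M \<in> Fun P C"
  shows "height_interleaved P \<rho> C r M M"
proof -
  have "shift_family r M M (\<lambda>x y. far M (x, y))"
    unfolding shift_family_def by (auto simp: far_in[OF M] far_comp[OF M] dest: gapD)
  moreover have "inverse_shifts r M (\<lambda>x y. far M (x, y)) (\<lambda>x y. far M (x, y))"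
    unfolding inverse_shifts_def by (blast intro: far_comp[OF M] gapD)
  ultimately show ?thesis
    unfolding height_interleaved_iff[OF M M] by blast
qed

text \<open>The value is junk on pairs \<open>x\<close>, \<open>y\<close> without an intermediate point.\<close>

definition shift_comp ::
  "real \<Rightarrow> real \<Rightarrow> ('u \<Rightarrow> 'u \<Rightarrow> 'm) \<Rightarrow> ('u \<Rightarrow> 'u \<Rightarrow> 'm) \<Rightarrow> 'u \<Rightarrow> 'u \<Rightarrow> 'm" where
  "shift_comp s r \<phi> \<psi> x y =
     (let z = SOME z. gap s x z \<and> gap r z y in Comp C (\<psi> z y) (\<phi> x z))"

text \<open>The composite is unchanged when the intermediate point moves along a comparability, and
  CIP joins the chosen point to \<open>z\<close> by a zigzag of intermediate points.\<close>

lemma shift_comp_eq: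
  assumes X: "X \<in> Fun P C" and "CIP P \<rho>"
    and "0 \<le> s" "0 \<le> r"
    and \<phi>: "shift_family s M X \<phi>" and \<psi>: "shift_family r X N \<psi>"
    and z: "gap s x z" "gap r z y"
  shows "shift_comp s r \<phi> \<psi> x y = Comp C (\<psi> z y) (\<phi> x z)"
proof -
  let ?S = "down P \<rho> r y \<inter> up P \<rho> s x"
  define w where "w = (SOME z. gap s x z \<and> gap r z y)"
  have w: "gap s x w" "gap r w y"
    unfolding w_def using someI[of "\<lambda>z. gap s x z \<and> gap r z y" z] z by blast+
  \<comment> \<open>The map of \<open>X\<close> from \<open>u\<close> to \<open>v\<close> can be
    absorbed by \<phi> on one side or by \<psi> on the other.\<close>
  have le: "Comp C (\<psi> v y) (\<phi> x v) = Comp C (\<psi> u y) (\<phi> x u)"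
    if "(u, v) \<in> P" "gap s x u" "gap r v y" for u v
  proof -
    have "Comp C (\<psi> v y) (\<phi> x v) = Comp C (\<psi> v y) (Comp C (far X (u, v)) (\<phi> x u))"
      by (simp add: far_shift[OF \<phi> that(2,1)])
    also have "\<dots> = Comp C (Comp C (\<psi> v y) (far X (u, v))) (\<phi> x u)"
      using that by (intro comp_assoc[OF shift_in[OF \<phi>] far_in[OF X] shift_in[OF \<psi>]])
    also have "\<dots> = Comp C (\<psi> u y) (\<phi> x u)"
      by (simp add: shift_far[OF \<psi> that(1,3)])
    finally show ?thesis .
  qed
  have "zigzag_connected P ?S"
    using \<open>CIP P \<rho>\<close> \<open>0 \<le> s\<close> \<open>0 \<le> r\<close> gap_Field[OF z(1)] gap_Field[OF z(2)] unfolding CIP_def by blast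
  then have "(w, z) \<in> (Restr (P \<union> P\<inverse>) ?S)\<^sup>*"
    using w z unfolding zigzag_connected_def by simp
  then have "Comp C (\<psi> z y) (\<phi> x z) = Comp C (\<psi> w y) (\<phi> x w)"
  proof (induction rule: rtrancl_induct)
    case (step u v)
    then show ?case
      using le[of u v] le[of v u] by auto
  qed simp
  then show ?thesis
    by (simp add: shift_comp_def w_def Let_def)
qed

text \<open>A point between \<open>x\<close> and \<open>y\<close> remains intermediate when
  \<open>x\<close> is lowered or \<open>y\<close> is raised. Both sides of each equation can thus be
  computed through the same \<open>z\<close>, where they reduce to absorption by \<phi> or
  \<psi>.\<close>

lemma shift_family_shift_comp:
  assumes M: "M \<in> Fun P C" and X: "X \<in> Fun P C" and N: "N \<in> Fun P C" and CIP: "CIP P \<rho>"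
    and nonneg: "0 \<le> s" "0 \<le> r"
    and \<phi>: "shift_family s M X \<phi>" and \<psi>: "shift_family r X N \<psi>"
    and split: "\<And>x y. gap t x y \<Longrightarrow> \<exists>z. gap s x z \<and> gap r z y"
  shows "shift_family t M N (shift_comp s r \<phi> \<psi>)"
proof -
  note eq = shift_comp_eq[OF X CIP nonneg \<phi> \<psi>]
  show ?thesis
    unfolding shift_family_def
  proof (intro conjI allI impI)
    fix x y assume "gap t x y"
    then obtain z where z: "gap s x z" "gap r z y"
      using split by blast
    then show "shift_comp s r \<phi> \<psi> x y \<in> Hom C (fob M x) (fob N y)"
      using comp_in[OF shift_in[OF \<phi> z(1)] shift_in[OF \<psi> z(2)]] by (simp add: eq[OF z])
  next
    fix x y y' assume "gap t x y" and y': "(y, y') \<in> P"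
    then obtain z where z: "gap s x z" "gap r z y"
      using split by blast
    show "Comp C (far N (y, y')) (shift_comp s r \<phi> \<psi> x y) = shift_comp s r \<phi> \<psi> x y'"
      by (simp add: eq[OF z] eq[OF z(1) gap_trans1[OF z(2) y']] far_shift[OF \<psi> z(2) y']
          comp_assoc[OF shift_in[OF \<phi> z(1)] shift_in[OF \<psi> z(2)] far_in[OF N y']])
  next
    fix x x' y assume x': "(x, x') \<in> P" and "gap t x' y"
    then obtain z where z: "gap s x' z" "gap r z y"
      using split by blast
    show "Comp C (shift_comp s r \<phi> \<psi> x' y) (far M (x, x')) = shift_comp s r \<phi> \<psi> x y"
      by (simp add: eq[OF z] eq[OF gap_trans2[OF x' z(1)] z(2)] shift_far[OF \<phi> x' z(1)]
          comp_assoc[OF far_in[OF M x'] shift_in[OF \<phi> z(1)] shift_in[OF \<psi> z(2)], symmetric])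
  qed
qed

text \<open>The fourfold composite telescopes: the inner pair collapses to a structure map of
  \<open>X\<close>, which \<phi>' absorbs, and the remaining pair collapses to a structure map of
  \<open>M\<close>.\<close>

lemma inverse_shifts_shift_comp:
  assumes X: "X \<in> Fun P C" and CIP: "CIP P \<rho>"
    and nonneg: "0 \<le> s" "0 \<le> r"
    and \<phi>: "shift_family s M X \<phi>" and \<phi>': "shift_family s X M \<phi>'"
    and \<psi>: "shift_family r X N \<psi>" and \<psi>': "shift_family r N X \<psi>'"
    and inv: "inverse_shifts s M \<phi> \<phi>'" "inverse_shifts r X \<psi> \<psi>'"
    and split: "\<And>x y. gap t x y \<Longrightarrow> \<exists>z. gap s x z \<and> gap r z y"
      "\<And>x y. gap t x y \<Longrightarrow> \<exists>z. gap r x z \<and> gap s z y"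
  shows "inverse_shifts t M (shift_comp s r \<phi> \<psi>) (shift_comp r s \<psi>' \<phi>')"
  unfolding inverse_shifts_def
proof (intro allI impI)
  fix x a y assume "gap t x a" "gap t a y"
  then obtain z w where z: "gap s x z" "gap r z a" and w: "gap r a w" "gap s w y"
    using split by meson
  have zw: "(z, w) \<in> P"
    using z(2) w(1) by (blast intro: P_trans gapD)
  note in_Hom = shift_in[OF \<phi> z(1)] shift_in[OF \<psi> z(2)] shift_in[OF \<psi>' w(1)] shift_in[OF \<phi>' w(2)]
  have "Comp C (Comp C (\<phi>' w y) (\<psi>' a w)) (Comp C (\<psi> z a) (\<phi> x z)) =
      Comp C (Comp C (\<phi>' w y) (Comp C (\<psi>' a w) (\<psi> z a))) (\<phi> x z)"
    by (simp add: comp_assoc[OF in_Hom(1,2) comp_in[OF in_Hom(3,4)]] comp_assoc[OF in_Hom(2-4)])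
  also have "Comp C (\<psi>' a w) (\<psi> z a) = far X (z, w)"
    using inv(2) z w by (simp add: inverse_shifts_def)
  also have "Comp C (\<phi>' w y) (far X (z, w)) = \<phi>' z y"
    by (rule shift_far[OF \<phi>' zw w(2)])
  \<comment> \<open>From \<open>z\<close> below \<open>w\<close> and the gap between
    \<open>w\<close> and \<open>y\<close> there is a gap of size \<open>s\<close> between
    \<open>z\<close> and \<open>y\<close>, so the inverse equation applies at
    \<open>z\<close>.\<close>
  also have "Comp C (\<phi>' z y) (\<phi> x z) = far M (x, y)"
    using inv(1) z(1) gap_trans2[OF zw w(2)] by (simp add: inverse_shifts_def)
  finally show "Comp C (shift_comp r s \<psi>' \<phi>' a y) (shift_comp s r \<phi> \<psi> x a) = far M (x, y)"
    by (simp add: shift_comp_eq[OF X CIP nonneg \<phi> \<psi> z]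
        shift_comp_eq[OF X CIP nonneg(2,1) \<psi>' \<phi>' w])
qed

end

section \<open>Intermediate points from the relaxed intermediate value condition\<close>

lemma absdiff_leD:
  assumes "absdiff u (ennreal v) \<le> ennreal c" "0 \<le> v" "0 \<le> c"
  shows "ennreal (v - c) \<le> u"
proof (cases u)
  case (real u')
  then show ?thesis
    using assms by (auto simp: absdiff_def ennreal_le_iff2 abs_le_iff intro!: ennreal_leI split: if_splits)
qed auto

context height_poset
begin

text \<open>Cutting at height \<open>s + c / 2\<close> with error \<open>c / 2\<close> leaves at
  least \<open>s\<close> below the cut and at least
  \<open>(s + r + c) - (s + c / 2) - c / 2 = r\<close> above it.\<close>

lemma IV_split:
  assumes IV: "IV P \<rho> c" and nonneg: "0 \<le> s" "0 \<le> r" "0 \<le> c" and gap: "gap (s + r + c) x y"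
  shows "\<exists>z. gap s x z \<and> gap r z y"
proof -
  have xy: "(x, y) \<in> P" and le: "ennreal (s + r + c) \<le> \<rho> x y"
    using gap by (auto simp: gap_def)
  have "ennreal (s + c / 2) \<le> \<rho> x y"
    using le by (rule order_trans[rotated]) (use nonneg in \<open>intro ennreal_leI, simp\<close>)
  then obtain z where z: "(x, z) \<in> P" "(z, y) \<in> P"
    and xz: "absdiff (\<rho> x z) (ennreal (s + c / 2)) \<le> ennreal (c / 2)"
    and zy: "absdiff (\<rho> z y) (\<rho> x y - ennreal (s + c / 2)) \<le> ennreal (c / 2)"
    using IV xy nonneg unfolding IV_def by (meson add_nonneg_nonneg divide_nonneg_nonneg zero_le_numeral)
  have "ennreal s \<le> \<rho> x z"
    using absdiff_leD[OF xz] nonneg by simp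
  moreover have "ennreal r \<le> \<rho> z y"
  proof (cases "\<rho> x y")
    case (real h)
    then have "s + r + c \<le> h"
      using le nonneg by (simp del: ennreal_plus)
    moreover have "\<rho> x y - ennreal (s + c / 2) = ennreal (h - (s + c / 2))"
      using real nonneg by (simp add: ennreal_minus del: ennreal_plus)
    ultimately have "ennreal (h - (s + c / 2) - c / 2) \<le> \<rho> z y"
      using zy nonneg by (intro absdiff_leD) auto
    then show ?thesis
      by (rule order_trans[rotated]) (use \<open>s + r + c \<le> h\<close> in \<open>intro ennreal_leI, simp\<close>)
  next
    \<comment> \<open>Here the remaining height is infinite, and a finite error forces the upper
      part to be infinite too.\<close>
    case top
    then have "absdiff (\<rho> z y) \<infinity> \<le> ennreal (c / 2)"
      using zy by simp
    then have "\<rho> z y = \<infinity>"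
      by (simp add: absdiff_def top_unique split: if_splits)
    then show ?thesis
      by simp
  qed
  ultimately show ?thesis
    using z by (auto simp: gap_def)
qed

theorem height_interleaved_trans:
  assumes M: "M \<in> Fun P C" and X: "X \<in> Fun P C" and N: "N \<in> Fun P C" and CIP: "CIP P \<rho>"
    and IV: "IV P \<rho> c" and nonneg: "0 \<le> s" "0 \<le> r" "0 \<le> c"
    and MX: "height_interleaved P \<rho> C s M X" and XN: "height_interleaved P \<rho> C r X N"
  shows "height_interleaved P \<rho> C (s + r + c) M N"
proof -
  obtain \<phi> \<phi>' where \<phi>: "shift_family s M X \<phi>" "shift_family s X M \<phi>'"
    "inverse_shifts s M \<phi> \<phi>'" "inverse_shifts s X \<phi>' \<phi>"
    using MX unfolding height_interleaved_iff[OF M X] by blast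
  obtain \<psi> \<psi>' where \<psi>: "shift_family r X N \<psi>" "shift_family r N X \<psi>'"
    "inverse_shifts r X \<psi> \<psi>'" "inverse_shifts r N \<psi>' \<psi>"
    using XN unfolding height_interleaved_iff[OF X N] by blast
  \<comment> \<open>From \<open>M\<close> to \<open>N\<close> the shift \<open>s\<close> comes
    first, on the way back \<open>r\<close> does; commuting the sum gives both splittings the same
    total shift.\<close>
  note split = IV_split[OF IV nonneg] IV_split[OF IV nonneg(2,1,3), unfolded add.commute[of r s]]
  show ?thesis
    unfolding height_interleaved_iff[OF M N]
    using shift_family_shift_comp[OF M X N CIP nonneg(1,2) \<phi>(1) \<psi>(1) split(1)]
      shift_family_shift_comp[OF N X M CIP nonneg(2,1) \<psi>(2) \<phi>(2) split(2)]
      inverse_shifts_shift_comp[OF X CIP nonneg(1,2) \<phi>(1,2) \<psi>(1,2) \<phi>(3) \<psi>(3) split]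
      inverse_shifts_shift_comp[OF X CIP nonneg(2,1) \<psi>(2,1) \<phi>(2,1) \<psi>(4) \<phi>(4) split(2,1)]
    by blast
qed

end

section \<open>The interleaving distance\<close>

lemma height_dist_le: "0 \<le> r \<Longrightarrow> height_interleaved P \<rho> C r M N \<Longrightarrow> height_dist P \<rho> C M N \<le> ennreal r"
  unfolding height_dist_def by (blast intro: Inf_lower)

lemma height_dist_sym: "height_dist P \<rho> C M N = height_dist P \<rho> C N M"
proof -
  have "height_interleaved P \<rho> C r M N \<longleftrightarrow> height_interleaved P \<rho> C r N M" for r
    unfolding height_interleaved_def by blast
  then show ?thesis
    by (simp add: height_dist_def)
qed

text \<open>A finite infimum increases strictly when a positive \<epsilon> is added. This gives
  near-optimal parameters even if the infimum is not attained.\<close>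

lemma Inf_ennreal_approx:
  assumes "Inf {ennreal r |r. 0 \<le> r \<and> Q r} < top" "0 < \<epsilon>"
  obtains r where "0 \<le> r" "Q r" "ennreal r \<le> Inf {ennreal r |r. 0 \<le> r \<and> Q r} + ennreal \<epsilon>"
proof -
  let ?I = "Inf {ennreal r |r. 0 \<le> r \<and> Q r}"
  have "?I < ?I + ennreal \<epsilon>"
    using assms by (cases ?I) (auto simp flip: ennreal_plus simp: ennreal_less_iff)
  then show thesis
    using that unfolding Inf_less_iff by (auto intro: less_imp_le)
qed

theorem theorem1p2:
  fixes P :: "'u rel"
    and \<rho> :: "'u \<Rightarrow> 'u \<Rightarrow> ennreal"
    and C :: "('o, 'm) cat"
  assumes "Partial_order P"
    and "height_difference P \<rho>"
    and "complete_category TYPE('u) C"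
    and "cocomplete_category TYPE('u) C"
    and "CIP P \<rho>"
  shows "(\<forall>M \<in> Fun P C. \<forall>X \<in> Fun P C. \<forall>N \<in> Fun P C.
            height_dist P \<rho> C M N \<le> height_dist P \<rho> C M X + height_dist P \<rho> C X N + c_rho P \<rho>) \<and>
         (c_rho P \<rho> = 0 \<longrightarrow> extended_pseudo_distance (Fun P C) (height_dist P \<rho> C))"
proof -
  interpret category C
    using assms(3) by (simp add: complete_category_def)
  interpret height_poset C P \<rho>
    using assms by unfold_locales
  have tri: "height_dist P \<rho> C M N \<le> height_dist P \<rho> C M X + height_dist P \<rho> C X N + c_rho P \<rho>"
    if M: "M \<in> Fun P C" and X: "X \<in> Fun P C" and N: "N \<in> Fun P C" for M X N
  proof (cases "height_dist P \<rho> C M X < top \<and> height_dist P \<rho> C X N < top \<and> c_rho P \<rho> < top")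
    case True
    show ?thesis
    proof (rule ennreal_le_epsilon)
      fix \<epsilon> :: real assume "0 < \<epsilon>"
      \<comment> \<open>The error is shared among three infima: the two distances and
        \<open>c_rho\<close>.\<close>
      then have \<epsilon>: "0 < \<epsilon> / 3"
        by simp
      obtain s where s: "0 \<le> s" "height_interleaved P \<rho> C s M X"
        "ennreal s \<le> height_dist P \<rho> C M X + ennreal (\<epsilon> / 3)"
        using Inf_ennreal_approx[of "\<lambda>s. height_interleaved P \<rho> C s M X" "\<epsilon> / 3"] True \<epsilon>
        unfolding height_dist_def by blast
      obtain r where r: "0 \<le> r" "height_interleaved P \<rho> C r X N"
        "ennreal r \<le> height_dist P \<rho> C X N + ennreal (\<epsilon> / 3)"
        using Inf_ennreal_approx[of "\<lambda>r. height_interleaved P \<rho> C r X N" "\<epsilon> / 3"] True \<epsilon>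
        unfolding height_dist_def by blast
      obtain c where c: "0 \<le> c" "IV P \<rho> c" "ennreal c \<le> c_rho P \<rho> + ennreal (\<epsilon> / 3)"
        using Inf_ennreal_approx[of "IV P \<rho>" "\<epsilon> / 3"] True \<epsilon> unfolding c_rho_def by blast
      have "height_dist P \<rho> C M N \<le> ennreal (s + r + c)"
        using height_interleaved_trans[OF M X N assms(5) c(2) s(1) r(1) c(1) s(2) r(2)] s(1) r(1) c(1)
        by (intro height_dist_le) auto
      also have "\<dots> = ennreal s + ennreal r + ennreal c"
        using s(1) r(1) c(1) by simp
      also have "\<dots> \<le> (height_dist P \<rho> C M X + ennreal (\<epsilon> / 3)) +
          (height_dist P \<rho> C X N + ennreal (\<epsilon> / 3)) + (c_rho P \<rho> + ennreal (\<epsilon> / 3))"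
        using s(3) r(3) c(3) by (intro add_mono)
      also have "\<dots> = height_dist P \<rho> C M X + height_dist P \<rho> C X N + c_rho P \<rho> +
          (ennreal (\<epsilon> / 3) + ennreal (\<epsilon> / 3) + ennreal (\<epsilon> / 3))"
        by (simp only: ac_simps)
      also have "ennreal (\<epsilon> / 3) + ennreal (\<epsilon> / 3) + ennreal (\<epsilon> / 3) = ennreal \<epsilon>"
        using \<open>0 < \<epsilon>\<close> by (simp flip: ennreal_plus)
      finally show "height_dist P \<rho> C M N \<le>
          height_dist P \<rho> C M X + height_dist P \<rho> C X N + c_rho P \<rho> + ennreal \<epsilon>" .
    qed
  next
    case False
    then show ?thesis
      \<comment> \<open>An infinite summand makes the right-hand side infinite.\<close>
      by (auto simp flip: less_top)
  qed
  have "height_dist P \<rho> C M M = 0" if "M \<in> Fun P C" for M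
    using height_dist_le[OF order_refl height_interleaved_refl[OF that]] by simp
  with tri show ?thesis
    unfolding extended_pseudo_distance_def using height_dist_sym[of P \<rho> C] by auto
qed

end
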